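(* Let $\mathbb{D}^2=\{z\in\mathbb{C}:|z|<1\}$ and let $\delta_{\mathbb{D}^2}$ be its Apollonian weak metric. The mean-value symmetrization $S\delta_{\mathbb{D}^2}$ coincides with the Poincaré metric $h_{\mathbb{D}^2}$ of the disk: for all $x,y\in\mathbb{D}^2$, $$S\delta_{\mathbb{D}^2}(x,y)=\frac12\left(\delta_{\mathbb{D}^2}(x,y)+\delta_{\mathbb{D}^2}(y,x)\right)=h_{\mathbb{D}^2}(x,y)=\frac12\log\left(\frac{|1-x\overline{y}|+|x-y|}{|1-x\overline{y}|-|x-y|}\right).$$
   Context: The Apollonian weak metric of the unit disk is $\delta_{\mathbb{D}^2}(x,y)=\sup_{|a|=1}\log\frac{|x-a|}{|y-a|}$ for $x,y\in\mathbb{D}^2$. For a function $\delta:X\times X\to[0,\infty)$, the mean-value symmetrization is $S\delta(x,y)=\frac12(\delta(x,y)+\delta(y,x))$. The Poincaré metric $h_{\mathbb{D}^2}$ is normalized so that it is given by $h_{\mathbb{D}^2}(x,y)=\frac12\log\left(\frac{|1-x\overline{y}|+|x-y|}{|1-x\overline{y}|-|x-y|}\right)$. *)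

theory Defs
  imports "HOL-Analysis.Analysis"
begin

abbreviation unit_disk :: "complex set" where
  "unit_disk \<equiv> {z. cmod z < 1}"

(* Only meaningful for x, y in the unit disk, where the family is bounded above
   (see apollonian_disk_bdd_above), so that the real supremum is the true one. *)
definition apollonian_disk :: "complex \<Rightarrow> complex \<Rightarrow> real" where
  "apollonian_disk x y = (SUP a\<in>{a. cmod a = 1}. ln (cmod (x - a) / cmod (y - a)))"

definition mean_value_symmetrization :: "('a \<Rightarrow> 'a \<Rightarrow> real) \<Rightarrow> 'a \<Rightarrow> 'a \<Rightarrow> real" where
  "mean_value_symmetrization d x y = 1/2 * (d x y + d y x)"

(* Normalized to constant curvature -4, i.e. length element |dz| / (1 - |z|^2). *)
definition poincare_disk :: "complex \<Rightarrow> complex \<Rightarrow> real" where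
  "poincare_disk x y =
     1/2 * ln ((cmod (1 - x * cnj y) + cmod (x - y)) / (cmod (1 - x * cnj y) - cmod (x - y)))"

lemma apollonian_disk_bdd_above:
  assumes "x \<in> unit_disk" "y \<in> unit_disk"
  shows "bdd_above ((\<lambda>a. ln (cmod (x - a) / cmod (y - a))) ` {a. cmod a = 1})"
proof (rule bdd_aboveI2)
  fix a :: complex assume "a \<in> {a. cmod a = 1}"
  then have a: "cmod a = 1" by simp
  have y: "1 - cmod y \<le> cmod (y - a)"
    using norm_triangle_ineq2[of a y] a by (simp add: norm_minus_commute)
  have x: "cmod (x - a) \<le> 2" "0 < cmod (x - a)"
    using norm_triangle_ineq4[of x a] a assms by auto
  have "cmod (x - a) / cmod (y - a) \<le> 2 / (1 - cmod y)"
    using x y assms by (intro frac_le) auto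
  moreover have "0 < cmod (x - a) / cmod (y - a)"
    using x y assms by (intro divide_pos_pos) auto
  ultimately show "ln (cmod (x - a) / cmod (y - a)) \<le> ln (2 / (1 - cmod y))"
    by (smt (verit) ln_le_cancel_iff)
qed

lemma apollonian_disk_nonneg:
  assumes "x \<in> unit_disk" "y \<in> unit_disk"
  shows "0 \<le> apollonian_disk x y"
proof -
  have "\<exists>a. cmod a = 1 \<and> cmod (y - a) \<le> cmod (x - a)"
  proof (cases "x = y")
    case True
    then show ?thesis by (auto intro: exI[of _ 1])
  next
    case False
    define a where "a = sgn (y - x)"
    have a: "cmod a = 1" using False by (simp add: a_def norm_sgn)
    have "(y - x) \<bullet> a = cmod (y - x)"
      using False by (simp add: a_def sgn_div_norm dot_square_norm power2_eq_square)
    then have "(cmod (x - a))\<^sup>2 - (cmod (y - a))\<^sup>2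
        = (cmod x)\<^sup>2 - (cmod y)\<^sup>2 + 2 * cmod (y - x)"
      by (simp add: power2_norm_eq_inner inner_diff_left inner_diff_right inner_commute)
    moreover have "(cmod y)\<^sup>2 - (cmod x)\<^sup>2 \<le> 2 * cmod (y - x)"
    proof -
      have "(cmod y)\<^sup>2 - (cmod x)\<^sup>2 = (cmod y + cmod x) * (cmod y - cmod x)"
        by (simp add: power2_eq_square algebra_simps)
      also have "\<dots> \<le> (cmod y + cmod x) * cmod (y - x)"
        by (intro mult_left_mono norm_triangle_ineq2) auto
      also have "\<dots> \<le> 2 * cmod (y - x)"
        using assms by (intro mult_right_mono) auto
      finally show ?thesis .
    qed
    ultimately have "(cmod (y - a))\<^sup>2 \<le> (cmod (x - a))\<^sup>2" by linarith
    then show ?thesis using a by (auto simp: power2_le_iff_abs_le)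
  qed
  then obtain a where a: "cmod a = 1" "cmod (y - a) \<le> cmod (x - a)" by blast
  have "y \<noteq> a" using a assms by auto
  then have "0 \<le> ln (cmod (x - a) / cmod (y - a))"
    using a by (intro ln_ge_zero) (simp add: le_divide_eq)
  also have "\<dots> \<le> apollonian_disk x y"
    unfolding apollonian_disk_def
    using a by (intro cSUP_upper apollonian_disk_bdd_above assms) auto
  finally show ?thesis .
qed

end

theory Submission
  imports Defs
begin

text \<open>For \<open>|a| = 1\<close> we have \<open>|1 - a cnj y| = |y - a|\<close>, and
  \<open>(x - a) (1 - |y|\<^sup>2) = (x - y) (1 - a cnj y) + (1 - x cnj y) (y - a)\<close>. Hence
  \<open>|x - a| / |y - a| \<le> (|1 - x cnj y| + |x - y|) / (1 - |y|\<^sup>2)\<close>, and equality is attained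
  because \<open>a \<mapsto> (y - a) / (1 - a cnj y)\<close> maps the unit circle onto itself. The symmetrization
  then follows from \<open>|1 - x cnj y|\<^sup>2 - |x - y|\<^sup>2 = (1 - |x|\<^sup>2) (1 - |y|\<^sup>2)\<close>.\<close>

text \<open>As \<open>a * cnj a = 1\<close>, the number \<open>1 - cnj y * a\<close> is
  \<open>cnj (a - y)\<close> rotated by \<open>a\<close>.\<close>

lemma norm_diff_unit_circle:
  assumes "cmod a = 1"
  shows "cmod (1 - cnj y * a) = cmod (y - a)"
proof -
  have "1 - cnj y * a = a * cnj (a - y)"
    using assms complex_norm_square[of a] by (simp add: algebra_simps)
  then show ?thesis
    by (simp only: norm_mult complex_mod_cnj assms norm_minus_commute mult_1_left)
qed

text \<open>Both sides are affine in \<open>x\<close> and agree at \<open>x = y\<close> and at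
  \<open>x = a\<close>. For \<open>a\<close> on the unit circle both summands have modulus a
  multiple of \<open>cmod (y - a)\<close>.\<close>

lemma diff_unit_circle_decomposition:
  "(x - a) * of_real (1 - (cmod y)\<^sup>2) = (x - y) * (1 - cnj y * a) + (1 - x * cnj y) * (y - a)"
  by (simp only: of_real_diff of_real_1 complex_norm_square) (simp add: algebra_simps)

lemma norm_ratio_unit_circle_le:
  assumes "cmod y < 1" "cmod a = 1"
  shows "cmod (x - a) / cmod (y - a) \<le> (cmod (1 - x * cnj y) + cmod (x - y)) / (1 - (cmod y)\<^sup>2)"
proof -
  have y: "0 < 1 - (cmod y)\<^sup>2"
    using assms by (simp add: power_less_one_iff)
  have ya: "0 < cmod (y - a)"
    using assms by auto
  have "cmod (x - a) * (1 - (cmod y)\<^sup>2) = cmod ((x - a) * of_real (1 - (cmod y)\<^sup>2))"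
    using y by (simp only: norm_mult norm_of_real abs_of_pos)
  also have "\<dots> \<le> cmod (x - y) * cmod (y - a) + cmod (1 - x * cnj y) * cmod (y - a)"
    unfolding diff_unit_circle_decomposition
    by (metis norm_triangle_ineq norm_mult norm_diff_unit_circle[OF assms(2)])
  finally show ?thesis
    using y ya by (simp add: field_simps)
qed

text \<open>The triangle inequality is an equality once the two summands of the decomposition point
  in the same direction; \<open>a\<close> is solved from that condition.\<close>

lemma norm_ratio_unit_circle_attained:
  assumes "cmod x < 1" "cmod y < 1"
  obtains a where "cmod a = 1"
    "cmod (x - a) / cmod (y - a) = (cmod (1 - x * cnj y) + cmod (x - y)) / (1 - (cmod y)\<^sup>2)"
proof -
  define p q where "p = 1 - x * cnj y" and "q = x - y"
  have y: "0 < 1 - (cmod y)\<^sup>2"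
    using assms by (simp add: power_less_one_iff)
  have "cmod (x * cnj y) < 1"
    using assms mult_left_le[of "cmod y" "cmod x"] by (simp add: norm_mult)
  then have p: "p \<noteq> 0"
    by (auto simp: p_def)
  \<comment> \<open>The unit factor that turns \<open>p\<close> into the direction of
    \<open>q\<close>. Since \<open>sgn 0 = 0\<close>, the case \<open>q = 0\<close> is set apart;
    any unit would do there.\<close>
  define u where "u = (if q = 0 then 1 else sgn q / sgn p)"
  have u: "cmod u = 1"
    using p by (simp add: u_def norm_sgn norm_divide)
  have pu: "cmod (q + p * u) = cmod p + cmod q"
  proof (cases "q = 0")
    case False
    have "q + p * u = of_real (cmod p + cmod q) * sgn q"
      using p False by (simp add: u_def sgn_eq field_simps)
    with False show ?thesis
      by (simp only: norm_mult norm_of_real norm_sgn) simp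
  qed (simp add: u_def)
  \<comment> \<open>The disk automorphism \<open>z \<mapsto> (y - z) / (1 - cnj y * z)\<close> is an
    involution, so the preimage of \<open>u\<close> is its image; \<open>ya\<close> below expresses
    this.\<close>
  define a where "a = (y - u) / (1 - cnj y * u)"
  have yu: "cmod (1 - cnj y * u) = cmod (y - u)" "y \<noteq> u"
    using norm_diff_unit_circle[OF u] u assms by auto
  then have nz: "1 - cnj y * u \<noteq> 0"
    by (metis norm_eq_zero right_minus_eq)
  have a: "cmod a = 1"
    using yu by (simp add: a_def norm_divide)
  have ya: "y - a = u * (1 - cnj y * a)"
    using nz by (simp add: a_def field_simps)
  have "(x - a) * of_real (1 - (cmod y)\<^sup>2) = q * (1 - cnj y * a) + p * (y - a)"
    unfolding p_def q_def by (rule diff_unit_circle_decomposition)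
  also have "\<dots> = (q + p * u) * (1 - cnj y * a)"
    by (subst ya) (simp only: distrib_right mult.assoc)
  finally have "(x - a) * of_real (1 - (cmod y)\<^sup>2) = (q + p * u) * (1 - cnj y * a)" .
  then have "cmod (x - a) * \<bar>1 - (cmod y)\<^sup>2\<bar> = (cmod p + cmod q) * cmod (y - a)"
    by (metis norm_mult norm_of_real pu norm_diff_unit_circle[OF a])
  moreover have "0 < cmod (y - a)"
    using a assms by auto
  ultimately have "cmod (x - a) / cmod (y - a) = (cmod p + cmod q) / (1 - (cmod y)\<^sup>2)"
    using y by (simp add: field_simps)
  with a that show thesis
    by (simp add: p_def q_def)
qed

lemma apollonian_disk_eq:
  assumes "cmod x < 1" "cmod y < 1"
  shows "apollonian_disk x y = ln ((cmod (1 - x * cnj y) + cmod (x - y)) / (1 - (cmod y)\<^sup>2))"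
proof -
  obtain b where b: "cmod b = 1"
    "cmod (x - b) / cmod (y - b) = (cmod (1 - x * cnj y) + cmod (x - y)) / (1 - (cmod y)\<^sup>2)"
    using norm_ratio_unit_circle_attained[OF assms] .
  \<comment> \<open>Monotonicity of \<open>ln\<close> is available only for positive arguments;
    \<open>x\<close> and \<open>y\<close> lie off the circle.\<close>
  have "0 < cmod (x - a) / cmod (y - a)" if "cmod a = 1" for a
    using that assms by (auto intro!: divide_pos_pos)
  then have "ln (cmod (x - a) / cmod (y - a)) \<le> ln (cmod (x - b) / cmod (y - b))"
    if "cmod a = 1" for a
    using norm_ratio_unit_circle_le[OF assms(2) that, of x] b that
    by (simp only: ln_mono)
  then show ?thesis
    unfolding apollonian_disk_def b(2)[symmetric]
    using b(1) by (intro cSup_eq_maximum) auto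
qed

text \<open>Expanding the squares on the left, the terms \<open>- 2 * Re (x * cnj y)\<close>
  cancel.\<close>

lemma norm_moebius_identity:
  "(cmod (1 - x * cnj y))\<^sup>2 - (cmod (x - y))\<^sup>2 = (1 - (cmod x)\<^sup>2) * (1 - (cmod y)\<^sup>2)"
proof -
  have "complex_of_real ((cmod (1 - x * cnj y))\<^sup>2 - (cmod (x - y))\<^sup>2)
      = of_real ((1 - (cmod x)\<^sup>2) * (1 - (cmod y)\<^sup>2))"
    by (simp only: of_real_diff of_real_mult of_real_1 complex_norm_square)
      (simp add: algebra_simps)
  then show ?thesis
    by (simp only: of_real_eq_iff)
qed

theorem corollary5p1:
  fixes x y :: complex
  assumes "x \<in> unit_disk" and "y \<in> unit_disk"
  shows "mean_value_symmetrization apollonian_disk x y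
           = 1/2 * (apollonian_disk x y + apollonian_disk y x)
       \<and> 1/2 * (apollonian_disk x y + apollonian_disk y x) = poincare_disk x y
       \<and> poincare_disk x y
           = 1/2 * ln ((cmod (1 - x * cnj y) + cmod (x - y))
                        / (cmod (1 - x * cnj y) - cmod (x - y)))"
proof -
  define P Q where "P = cmod (1 - x * cnj y)" and "Q = cmod (x - y)"
  define A B where "A = 1 - (cmod x)\<^sup>2" and "B = 1 - (cmod y)\<^sup>2"
  have AB: "0 < A" "0 < B"
    using assms by (simp_all add: A_def B_def power_less_one_iff)
  have PQ: "(P + Q) * (P - Q) = A * B"
    using norm_moebius_identity[of x y]
    by (simp add: P_def Q_def A_def B_def power2_eq_square algebra_simps)
  have "0 \<le> P + Q"
    by (simp add: P_def Q_def)
  \<comment> \<open>A positive product with one nonnegative factor has both factors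
    positive.\<close>
  with PQ AB have pos: "0 < P + Q" "0 < P - Q"
    by (metis mult_pos_pos mult_zero_left less_le zero_less_mult_pos)+
  \<comment> \<open>Swapping \<open>x\<close> and \<open>y\<close> conjugates
    \<open>1 - x * cnj y\<close>, so both distances share the numerator \<open>P + Q\<close> and
    differ only in the denominator.\<close>
  have "cmod (1 - y * cnj x) = P"
    unfolding P_def by (metis complex_cnj_cnj complex_cnj_diff complex_cnj_mult complex_cnj_one
        complex_mod_cnj mult.commute)
  then have "apollonian_disk x y + apollonian_disk y x = ln ((P + Q) / B) + ln ((P + Q) / A)"
    using assms by (simp add: apollonian_disk_eq P_def Q_def A_def B_def norm_minus_commute)
  also have "\<dots> = ln ((P + Q) / B * ((P + Q) / A))"
    using AB pos by (intro ln_mult_pos[symmetric]) auto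
  \<comment> \<open>Replacing \<open>A * B\<close> by \<open>(P + Q) * (P - Q)\<close> lets one
    factor \<open>P + Q\<close> cancel.\<close>
  also have "(P + Q) / B * ((P + Q) / A) = (P + Q) * (P + Q) / ((P + Q) * (P - Q))"
    unfolding PQ by simp
  also have "\<dots> = (P + Q) / (P - Q)"
    using pos by simp
  finally show ?thesis
    by (simp add: mean_value_symmetrization_def poincare_disk_def P_def Q_def)
qed

end
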